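(* Let $Y$ be a hereditarily unicoherent continuum, with compatible metric $d$. Suppose that for every $\varepsilon>0$ there exist two disjoint subcontinua of $Y$ each of which is $\varepsilon$-dense in $Y$. Then $Y$ is non-Suslinian.
   Context: A continuum is a compact connected metrizable space with more than one point; a subcontinuum of $Y$ is a subspace of $Y$ that is a continuum. A continuum $Y$ is hereditarily unicoherent if $H\cap K$ is connected for every two subcontinua $H$ and $K$ of $Y$ (the empty set counts as connected). A continuum $Y$ is Suslinian if it contains no uncountable collection of pairwise disjoint subcontinua, and non-Suslinian otherwise. A subset $E$ of a metric space $(Y,d)$ is $\varepsilon$-dense if $\sup_{y\in Y} d(y,E)<\varepsilon$. *)

theory Defs
  imports "HOL-Analysis.Analysis"
begin

definition continuum :: "'a topology \<Rightarrow> bool" where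
  "continuum Y \<longleftrightarrow>
     compact_space Y \<and> connected_space Y \<and> metrizable_space Y \<and>
     (\<exists>x\<in>topspace Y. \<exists>y\<in>topspace Y. x \<noteq> y)"

definition subcontinuum :: "'a topology \<Rightarrow> 'a set \<Rightarrow> bool" where
  "subcontinuum Y K \<longleftrightarrow> K \<subseteq> topspace Y \<and> continuum (subtopology Y K)"

text \<open>Subcontinua are nondegenerate, whereas the intersection below may be empty
  or a single point; both of these satisfy \<^const>\<open>connectedin\<close>.\<close>

definition hereditarily_unicoherent :: "'a topology \<Rightarrow> bool" where
  "hereditarily_unicoherent Y \<longleftrightarrow>
     (\<forall>H K. subcontinuum Y H \<and> subcontinuum Y K \<longrightarrow> connectedin Y (H \<inter> K))"

definition Suslinian :: "'a topology \<Rightarrow> bool" where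
  "Suslinian Y \<longleftrightarrow>
     \<not> (\<exists>\<C>. uncountable \<C> \<and> (\<forall>K\<in>\<C>. subcontinuum Y K) \<and> pairwise disjnt \<C>)"

text \<open>The distance from a point to a set and its supremum are taken in the extended reals, so
  that the distance to the empty set and an unbounded supremum are \<open>\<infinity>\<close>.\<close>

definition eps_dense :: "'a set \<Rightarrow> ('a \<Rightarrow> 'a \<Rightarrow> real) \<Rightarrow> real \<Rightarrow> 'a set \<Rightarrow> bool" where
  "eps_dense M d \<epsilon> E \<longleftrightarrow>
     E \<subseteq> M \<and> (SUP y\<in>M. INF e\<in>E. ereal (d y e)) < ereal \<epsilon>"

end

theory Submission
  imports Defs
begin

text \<open>
  A Suslinian continuum contains two disjoint subcontinua \<open>Q\<close> and \<open>R\<close> with nonempty interior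
  (\<open>Suslinian_disjoint_thick_subcontinua\<close>). To see this, take a proper closed set \<open>S\<close> with
  nonempty interior. By boundary bumping, no component of \<open>S\<close> that meets the interior of \<open>S\<close> is a
  single point, so these components are pairwise disjoint subcontinua and there are only countably
  many of them. They cover the interior of \<open>S\<close>, and Baire's theorem provides one with nonempty
  interior. Applying this twice, the second time outside the first subcontinuum, gives \<open>Q\<close> and \<open>R\<close>.

  If \<open>\<epsilon>\<close> is small, disjoint \<open>\<epsilon>\<close>-dense subcontinua \<open>H\<close> and \<open>K\<close> both meet both \<open>Q\<close> and \<open>R\<close>.
  Walking along \<open>Q\<close>, \<open>K\<close>, \<open>R\<close>, \<open>H\<close> and back to \<open>Q\<close> one goes around a circle: \<open>Q \<union> H\<close> and \<open>R \<union> K\<close> are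
  subcontinua, but their intersection is the union of the disjoint nonempty closed sets \<open>Q \<inter> K\<close>
  and \<open>H \<inter> R\<close>. This contradicts hereditary unicoherence.
\<close>

lemma continuum_imp_Hausdorff_space: "continuum Y \<Longrightarrow> Hausdorff_space Y"
  by (simp add: continuum_def metrizable_imp_Hausdorff_space)

lemma subcontinuum_iff_closedin_connectedin:
  assumes "continuum Y"
  shows "subcontinuum Y K \<longleftrightarrow>
    closedin Y K \<and> connectedin Y K \<and> (\<exists>x\<in>K. \<exists>y\<in>K. x \<noteq> y)"
proof -
  have "compactin Y K \<longleftrightarrow> closedin Y K"
    using assms closedin_compact_space [of Y K] compactin_imp_closedin [of Y K]
      continuum_imp_Hausdorff_space [of Y]
    by (auto simp: continuum_def)
  moreover have "metrizable_space (subtopology Y K)"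
    using assms by (simp add: continuum_def metrizable_space_subtopology)
  ultimately show ?thesis
    unfolding subcontinuum_def continuum_def compactin_subspace connectedin_def
    by (auto simp: topspace_subtopology_subset dest: closedin_subset)
qed

lemma subcontinuum_Un:
  assumes "continuum Y" "subcontinuum Y H" "subcontinuum Y K" "H \<inter> K \<noteq> {}"
  shows "subcontinuum Y (H \<union> K)"
  using assms by (auto simp: subcontinuum_iff_closedin_connectedin connectedin_Un)

text \<open>The component is nondegenerate: by boundary bumping it reaches the frontier of \<open>S\<close>, hence
  contains a point besides those it has in the interior of \<open>S\<close>.\<close>

lemma subcontinuum_component_meeting_interior:
  assumes Y: "continuum Y" and S: "closedin Y S" "S \<noteq> topspace Y"
    and C: "C \<in> connected_components_of (subtopology Y S)" "C \<inter> Y interior_of S \<noteq> {}"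
  shows "subcontinuum Y C"
proof -
  have "C \<inter> Y frontier_of S \<noteq> {}"
    using boundary_bumping_theorem_closed [of Y S C] Y S C continuum_imp_Hausdorff_space
    by (auto simp: continuum_def)
  then have "\<exists>x\<in>C. \<exists>y\<in>C. x \<noteq> y"
    using C(2) by (metis Diff_iff disjoint_iff frontier_of_def)
  moreover have "closedin Y C"
    using C(1) S(1) closedin_connected_components_of closedin_trans_full by blast
  moreover have "connectedin Y C"
    using C(1) connectedin_connected_components_of connectedin_subtopology by blast
  ultimately show ?thesis
    by (simp add: subcontinuum_iff_closedin_connectedin [OF Y])
qed

text \<open>The components of \<open>S\<close> that meet its interior are pairwise disjoint subcontinua covering
  that interior. As there are only countably many of them, one is not nowhere dense.\<close>

lemma Suslinian_thick_subcontinuum: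
  assumes Y: "continuum Y" "Suslinian Y"
    and S: "closedin Y S" "S \<noteq> topspace Y" "Y interior_of S \<noteq> {}"
  obtains Q where "subcontinuum Y Q" "Q \<subseteq> S" "Y interior_of Q \<noteq> {}"
proof -
  define \<C> where
    "\<C> = {C \<in> connected_components_of (subtopology Y S). C \<inter> Y interior_of S \<noteq> {}}"
  have sub: "subcontinuum Y C" if "C \<in> \<C>" for C
    using that subcontinuum_component_meeting_interior [OF Y(1) S(1,2)] by (simp add: \<C>_def)
  have "pairwise disjnt \<C>"
    by (rule pairwise_mono [OF pairwise_disjoint_connected_components_of]) (auto simp: \<C>_def)
  with sub Y(2) have "countable \<C>"
    unfolding Suslinian_def by blast
  have "Y interior_of S \<subseteq> \<Union>\<C>"
  proof
    fix x assume x: "x \<in> Y interior_of S"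
    then have "x \<in> topspace (subtopology Y S)"
      using interior_of_subset interior_of_subset_topspace by fastforce
    then obtain C where "C \<in> connected_components_of (subtopology Y S)" "x \<in> C"
      by (metis Union_connected_components_of UnionE)
    with x show "x \<in> \<Union>\<C>"
      by (auto simp: \<C>_def)
  qed
  then have "Y interior_of \<Union>\<C> \<noteq> {}"
    using S(3) interior_of_maximal by (metis openin_interior_of subset_empty)
  moreover have "locally_compact_space Y \<and> regular_space Y"
    using Y(1) compact_imp_locally_compact_space metrizable_imp_regular_space
    by (auto simp: continuum_def)
  moreover have "closedin Y C" if "C \<in> \<C>" for C
    using sub [OF that] by (simp add: subcontinuum_iff_closedin_connectedin [OF Y(1)])
  ultimately obtain Q where "Q \<in> \<C>" "Y interior_of Q \<noteq> {}"
    using Baire_category_alt [of Y \<C>] \<open>countable \<C>\<close> by blast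
  moreover from this have "Q \<subseteq> S"
    unfolding \<C>_def using connected_components_of_subset by fastforce
  ultimately show thesis
    using sub that by blast
qed

lemma Suslinian_disjoint_thick_subcontinua:
  assumes Y: "continuum Y" "Suslinian Y"
  obtains Q R where "subcontinuum Y Q" "subcontinuum Y R" "disjnt Q R"
    "Y interior_of Q \<noteq> {}" "Y interior_of R \<noteq> {}"
proof -
  obtain p q where pq: "p \<in> topspace Y" "q \<in> topspace Y" "p \<noteq> q"
    using Y(1) by (auto simp: continuum_def)
  then obtain U V where UV: "openin Y U" "openin Y V" "p \<in> U" "q \<in> V" "disjnt U V"
    using continuum_imp_Hausdorff_space [OF Y(1)] unfolding Hausdorff_space_def by metis
  then have "V \<subseteq> Y interior_of (topspace Y - U)"
    by (intro interior_of_maximal) (auto simp: disjnt_iff dest: openin_subset)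
  then obtain Q where Q: "subcontinuum Y Q" "Q \<subseteq> topspace Y - U" "Y interior_of Q \<noteq> {}"
    using Suslinian_thick_subcontinuum [OF Y, of "topspace Y - U"] UV pq by blast
  \<comment> \<open>The point \<open>p\<close> lies outside \<open>Q\<close>, so some closed neighbourhood of \<open>p\<close> misses \<open>Q\<close>.\<close>
  have "closedin Y Q"
    using Q(1) subcontinuum_iff_closedin_connectedin [OF Y(1)] by blast
  moreover have "regular_space Y"
    using Y(1) by (simp add: continuum_def metrizable_imp_regular_space)
  ultimately obtain W where W: "openin Y W" "p \<in> W" "disjnt Q (Y closure_of W)"
    using pq(1) UV(3) Q(2) unfolding regular_space by (metis DiffD2 DiffI subsetD)
  have "Q \<noteq> {}" "Q \<subseteq> topspace Y"
    using Q interior_of_subset by fastforce+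
  then have "Y closure_of W \<noteq> topspace Y"
    using W(3) by (auto simp: disjnt_iff)
  moreover have "W \<subseteq> Y interior_of (Y closure_of W)"
    using W(1) by (simp add: interior_of_maximal closure_of_subset openin_subset)
  then have "Y interior_of (Y closure_of W) \<noteq> {}"
    using W(2) by blast
  ultimately obtain R where "subcontinuum Y R" "R \<subseteq> Y closure_of W" "Y interior_of R \<noteq> {}"
    using Suslinian_thick_subcontinuum [OF Y closedin_closure_of] by blast
  with Q W(3) show thesis
    by (meson disjnt_subset2 that)
qed

lemma (in Metric_space) eps_dense_meets_mball:
  assumes "eps_dense M d r E" "x \<in> M"
  shows "E \<inter> mball x r \<noteq> {}"
proof -
  have "(INF e\<in>E. ereal (d x e)) \<le> (SUP y\<in>M. INF e\<in>E. ereal (d y e))"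
    using assms(2) by (rule SUP_upper)
  also have "\<dots> < ereal r"
    using assms(1) by (simp add: eps_dense_def)
  finally obtain e where "e \<in> E" "d x e < r"
    by (auto simp: INF_less_iff)
  moreover from this have "e \<in> mball x r"
    using assms by (auto simp: eps_dense_def)
  ultimately show ?thesis
    by blast
qed

lemma (in Metric_space) eventually_eps_dense_meets_openin:
  assumes "openin mtopology U" "U \<noteq> {}"
  shows "\<forall>\<^sub>F r in at_right 0. \<forall>E. eps_dense M d r E \<longrightarrow> E \<inter> U \<noteq> {}"
proof -
  obtain x r where "x \<in> M" "r > 0" "mball x r \<subseteq> U"
    using assms unfolding openin_mtopology by blast
  moreover have "mball x s \<subseteq> mball x r" if "s < r" for s
    using that by (simp add: mball_subset_concentric)
  ultimately have "E \<inter> U \<noteq> {}" if "0 < s" "s < r" "eps_dense M d s E" for s E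
    using that eps_dense_meets_mball [of s E x] by blast
  then show ?thesis
    unfolding eventually_at_right_field using \<open>r > 0\<close> by blast
qed

text \<open>Four such subcontinua are arranged like four arcs of a circle. The two halves \<open>H \<union> Q\<close> and
  \<open>K \<union> R\<close> are connected but meet in two separated pieces.\<close>

lemma hereditarily_unicoherent_no_circular_chain:
  assumes Y: "continuum Y" "hereditarily_unicoherent Y"
    and sub: "subcontinuum Y Q" "subcontinuum Y K" "subcontinuum Y R" "subcontinuum Y H"
    and "disjnt Q R" "disjnt K H"
    and meet: "Q \<inter> K \<noteq> {}" "K \<inter> R \<noteq> {}" "R \<inter> H \<noteq> {}" "H \<inter> Q \<noteq> {}"
  shows False
proof -
  have "subcontinuum Y (H \<union> Q)" "subcontinuum Y (K \<union> R)"
    using subcontinuum_Un Y(1) sub meet by blast+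
  then have "connectedin Y ((H \<union> Q) \<inter> (K \<union> R))"
    using Y(2) by (simp add: hereditarily_unicoherent_def)
  moreover have "(H \<union> Q) \<inter> (K \<union> R) = (Q \<inter> K) \<union> (R \<inter> H)"
    using \<open>disjnt Q R\<close> \<open>disjnt K H\<close> by (auto simp: disjnt_iff)
  ultimately have "connectedin Y ((Q \<inter> K) \<union> (R \<inter> H))"
    by simp
  moreover have "closedin Y (Q \<inter> K)" "closedin Y (R \<inter> H)"
    using sub subcontinuum_iff_closedin_connectedin [OF Y(1)] by blast+
  moreover have "(Q \<inter> K) \<inter> (R \<inter> H) = {}"
    using \<open>disjnt Q R\<close> by (auto simp: disjnt_iff)
  ultimately show False
    using meet(1,3) unfolding connectedin_closedin by blast
qed

theorem theorem1:
  fixes Y :: "'a topology" and d :: "'a \<Rightarrow> 'a \<Rightarrow> real"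
  assumes "continuum Y"
    and "hereditarily_unicoherent Y"
    and "Metric_space (topspace Y) d"
    and "Metric_space.mtopology (topspace Y) d = Y"
    and "\<And>\<epsilon>::real. \<epsilon> > 0 \<Longrightarrow>
           \<exists>H K. subcontinuum Y H \<and> subcontinuum Y K \<and> disjnt H K \<and>
                 eps_dense (topspace Y) d \<epsilon> H \<and> eps_dense (topspace Y) d \<epsilon> K"
  shows "\<not> Suslinian Y"
proof
  assume "Suslinian Y"
  then obtain Q R where QR: "subcontinuum Y Q" "subcontinuum Y R" "disjnt Q R"
      and int: "Y interior_of Q \<noteq> {}" "Y interior_of R \<noteq> {}"
    using Suslinian_disjoint_thick_subcontinua assms(1) by blast
  interpret Metric_space "topspace Y" d
    by (fact assms(3))
  have ev: "\<forall>\<^sub>F r in at_right 0. \<forall>E. eps_dense (topspace Y) d r E \<longrightarrow> E \<inter> Y interior_of A \<noteq> {}"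
    if "Y interior_of A \<noteq> {}" for A
    using that by (intro eventually_eps_dense_meets_openin) (simp_all add: assms(4))
  have "\<forall>\<^sub>F r::real in at_right 0. r > 0"
    by (rule eventually_at_right_less)
  with ev [OF int(1)] ev [OF int(2)]
  have "\<forall>\<^sub>F r in at_right 0. r > 0 \<and>
      (\<forall>E. eps_dense (topspace Y) d r E \<longrightarrow> E \<inter> Y interior_of Q \<noteq> {} \<and> E \<inter> Y interior_of R \<noteq> {})"
    by eventually_elim blast
  from eventually_happens' [OF trivial_limit_at_right_real this] obtain \<epsilon> where "\<epsilon> > 0"
    and int_meet: "\<And>E. eps_dense (topspace Y) d \<epsilon> E \<Longrightarrow>
      E \<inter> Y interior_of Q \<noteq> {} \<and> E \<inter> Y interior_of R \<noteq> {}"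
    by blast
  have meet: "E \<inter> Q \<noteq> {} \<and> E \<inter> R \<noteq> {}" if "eps_dense (topspace Y) d \<epsilon> E" for E
    using int_meet [OF that] interior_of_subset [of Y Q] interior_of_subset [of Y R] by fast
  from assms(5) [OF \<open>\<epsilon> > 0\<close>] obtain H K
    where HK: "subcontinuum Y H" "subcontinuum Y K" "disjnt H K"
      and "eps_dense (topspace Y) d \<epsilon> H" "eps_dense (topspace Y) d \<epsilon> K"
    by blast
  then have "Q \<inter> K \<noteq> {}" "K \<inter> R \<noteq> {}" "R \<inter> H \<noteq> {}" "H \<inter> Q \<noteq> {}"
    using meet by (simp_all add: Int_commute)
  with hereditarily_unicoherent_no_circular_chain [OF assms(1,2) QR(1) HK(2) QR(2) HK(1) QR(3)]
  show False
    using HK(3) by (simp add: disjnt_sym)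
qed

end
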